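(* For every positive integer $n$ and every $\pi\in S_n$, $$L_n(\pi)=\left(\frac{n!-n}{n!}\right)^2 L_n.$$
   Context: An $n$-th order Latin Square is an $n\times n$ grid filled with the symbols $1,\dots,n$ such that each symbol appears exactly once in each row and each column. $L_n$ denotes the total number of $n$-th order Latin Squares. Rows read left to right and columns read top to bottom give permutations of $\{1,\dots,n\}$. A permutation contains a pattern $\pi$ if some subsequence is order isomorphic to $\pi$, and avoids it otherwise (for $\pi\in S_n$ and a permutation of length $n$, containing $\pi$ means being equal to $\pi$). A Latin Square avoids $\pi$ if all its row and column permutations avoid $\pi$, and $L_n(\pi)$ is the number of $n$-th order Latin Squares avoiding $\pi$. *)

theory Defs
  imports Complex_Main "HOL-Library.FuncSet" "HOL-Combinatorics.Permutations"
begin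

text \<open>
  A grid is a function of the row index and the column index.  It is required to be
  \<^const>\<open>undefined\<close> outside the \<open>n \<times> n\<close> index range, so that each grid is represented by exactly
  one function and cardinalities count grids.
\<close>

definition latin_squares :: "nat \<Rightarrow> (nat \<Rightarrow> nat \<Rightarrow> nat) set" where
  "latin_squares n =
     {L \<in> {1..n} \<rightarrow>\<^sub>E ({1..n} \<rightarrow>\<^sub>E {1..n}).
        (\<forall>i\<in>{1..n}. \<forall>s\<in>{1..n}. \<exists>!j. j \<in> {1..n} \<and> L i j = s) \<and>
        (\<forall>j\<in>{1..n}. \<forall>s\<in>{1..n}. \<exists>!i. i \<in> {1..n} \<and> L i j = s)}"

lemma finite_latin_squares: "finite (latin_squares n)"
  unfolding latin_squares_def
  by (rule finite_subset[OF Collect_restrict]) (intro finite_PiE finite_atLeastAtMost)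

text \<open>
  The word \<open>w 1, \<dots>, w n\<close> contains the pattern \<open>p 1, \<dots>, p k\<close>: the strictly increasing \<open>f\<close> selects the
  positions of a subsequence of \<open>w\<close> that is order isomorphic to \<open>p\<close>.
\<close>

definition contains_pattern :: "nat \<Rightarrow> (nat \<Rightarrow> nat) \<Rightarrow> nat \<Rightarrow> (nat \<Rightarrow> nat) \<Rightarrow> bool" where
  "contains_pattern n w k p \<longleftrightarrow>
     (\<exists>f. strict_mono_on {1..k} f \<and> f ` {1..k} \<subseteq> {1..n} \<and>
        (\<forall>a\<in>{1..k}. \<forall>b\<in>{1..k}. w (f a) < w (f b) \<longleftrightarrow> p a < p b))"

definition latin_square_avoids :: "nat \<Rightarrow> (nat \<Rightarrow> nat \<Rightarrow> nat) \<Rightarrow> nat \<Rightarrow> (nat \<Rightarrow> nat) \<Rightarrow> bool" where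
  "latin_square_avoids n L k p \<longleftrightarrow>
     (\<forall>i\<in>{1..n}. \<not> contains_pattern n (\<lambda>j. L i j) k p) \<and>
     (\<forall>j\<in>{1..n}. \<not> contains_pattern n (\<lambda>i. L i j) k p)"

definition num_latin_squares :: "nat \<Rightarrow> nat" where
  "num_latin_squares n = card (latin_squares n)"

definition num_latin_squares_avoiding :: "nat \<Rightarrow> nat \<Rightarrow> (nat \<Rightarrow> nat) \<Rightarrow> nat" where
  "num_latin_squares_avoiding n k p = card {L \<in> latin_squares n. latin_square_avoids n L k p}"

end

theory Submission imports Defs begin

text \<open>
  Permuting columns shows that row \<open>i\<close> is equally often each of the \<open>n!\<close> permutations, and the rows of
  a square are distinct, so \<open>n \<cdot> L\<^sub>n / n!\<close> squares have a row equal to \<open>\<pi>\<close>; by transposition the same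
  holds for columns.  If row \<open>i\<close> and column \<open>j\<close> both equal \<open>\<pi>\<close>, comparing the entry at \<open>(i, j)\<close> gives
  \<open>\<pi> j = \<pi> i\<close>, so \<open>i = j\<close>.  Among the squares with row \<open>i\<close> equal to \<open>\<pi>\<close>, permuting the rows other than
  \<open>i\<close> shows that column \<open>i\<close> is equally often each of the \<open>(n-1)!\<close> permutations taking the value \<open>\<pi> i\<close>
  at \<open>i\<close>.  Hence \<open>n \<cdot> L\<^sub>n / (n! (n-1)!) = (n / n!)\<^sup>2 L\<^sub>n\<close> squares have both a row and a column
  equal to \<open>\<pi>\<close>, and inclusion-exclusion finishes the proof.
\<close>

section \<open>Patterns as long as the word\<close>

text \<open>Values of \<open>f\<close> grow by at least 1 at each step: upward induction from 1
  gives \<open>k \<le> f k\<close>, downward induction from \<open>n\<close> gives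
  \<open>f k \<le> k\<close>.\<close>

lemma strict_mono_on_interval_eq:
  fixes f :: "nat \<Rightarrow> nat"
  assumes mono: "strict_mono_on {1..n} f" and sub: "f ` {1..n} \<subseteq> {1..n}" and x: "x \<in> {1..n}"
  shows "f x = x"
proof (rule antisym)
  have "k \<in> {1..n} \<Longrightarrow> k \<le> f k" for k
  proof (induction k)
    case (Suc k)
    show ?case
    proof (cases "k = 0")
      \<comment> \<open>The interval starts at 1, so the induction hypothesis is void here and the
        bound comes from the range of \<open>f\<close>.\<close>
      case True
      have "f (Suc k) \<in> {1..n}" using sub Suc.prems by blast
      with True show ?thesis by simp
    next
      case False
      with Suc have "k \<le> f k" by simp
      also have "f k < f (Suc k)"
        using strict_mono_onD[OF mono, of k "Suc k"] Suc.prems False by simp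
      finally show ?thesis by simp
    qed
  qed simp
  with x show "x \<le> f x" by blast
  from x have "x \<le> n" "1 \<le> x" by auto
  then show "f x \<le> x"
  proof (induction rule: inc_induct)
    case base
    then have "f n \<in> f ` {1..n}" by (intro imageI) simp
    with sub have "f n \<in> {1..n}" by blast
    then show ?case by simp
  next
    case (step k)
    then have "f k < f (Suc k)"
      using strict_mono_onD[OF mono, of k "Suc k"] by simp
    with step show ?case by simp
  qed
qed

text \<open>The only possible choice of positions is the identity, so \<open>w\<close> and
  \<open>p\<close> order the positions alike. Equality is stated on the interval only because a row
  of a grid is \<open>undefined\<close> elsewhere, where \<open>p\<close> is the identity.\<close>

lemma contains_pattern_full_iff:
  assumes w: "bij_betw w {1..n} {1..n}" and p: "p permutes {1..n}"
  shows "contains_pattern n w n p \<longleftrightarrow> (\<forall>a\<in>{1..n}. w a = p a)"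
proof
  assume "contains_pattern n w n p"
  then obtain f where f: "strict_mono_on {1..n} f" "f ` {1..n} \<subseteq> {1..n}"
    and iso: "\<forall>a\<in>{1..n}. \<forall>b\<in>{1..n}. w (f a) < w (f b) \<longleftrightarrow> p a < p b"
    unfolding contains_pattern_def by blast
  \<comment> \<open>This lists the values of \<open>w\<close> by increasing value of
    \<open>p\<close>; order isomorphism makes \<open>g\<close> increasing, hence the
    identity.\<close>
  define g where "g = w \<circ> inv p"
  have inv: "inv p x \<in> {1..n}" if "x \<in> {1..n}" for x
    using that permutes_in_image[OF permutes_inv[OF p]] by blast
  have "strict_mono_on {1..n} g"
  proof (rule strict_mono_onI)
    fix x y assume xy: "x \<in> {1..n}" "y \<in> {1..n}" "x < y"
    have "f (inv p x) = inv p x" "f (inv p y) = inv p y"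
      using strict_mono_on_interval_eq[OF f] inv xy by auto
    then show "g x < g y"
      using iso[rule_format, OF inv inv, OF xy(1,2)] xy(3)
      by (simp add: g_def permutes_inverses[OF p])
  qed
  moreover have "g ` {1..n} \<subseteq> {1..n}"
    using inv bij_betw_apply[OF w] by (auto simp: g_def simp del: atLeastAtMost_iff)
  ultimately have g: "g x = x" if "x \<in> {1..n}" for x
    using strict_mono_on_interval_eq that by blast
  show "\<forall>a\<in>{1..n}. w a = p a"
  proof
    fix a assume "a \<in> {1..n}"
    then have "p a \<in> {1..n}" using permutes_in_image[OF p] by blast
    from g[OF this] show "w a = p a" by (simp add: g_def permutes_inverses[OF p])
  qed
next
  assume "\<forall>a\<in>{1..n}. w a = p a"
  then show "contains_pattern n w n p"
    unfolding contains_pattern_def by (intro exI[of _ id]) (auto simp: strict_mono_on_def)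
qed

section \<open>Counting tools\<close>

text \<open>Double counting of the pairs related by \<open>R\<close>. It serves both for squares
  against permutations and for squares against row indices.\<close>

lemma card_eq_mult_fibres:
  assumes "finite X" "finite F"
    and "\<And>x. x \<in> X \<Longrightarrow> \<exists>!s. s \<in> F \<and> R x s"
    and "\<And>s. s \<in> F \<Longrightarrow> card {x \<in> X. R x s} = k"
  shows "card X = k * card F"
proof -
  have "card {s \<in> F. R x s} = 1" if "x \<in> X" for x
    using assms(3)[OF that] by (auto simp: card_1_singleton_iff)
  then have "card X = (\<Sum>x\<in>X. card {s \<in> F. R x s})" by simp
  also have "\<dots> = k * card F"
    using assms by (intro sum_multicount) auto
  finally show ?thesis .
qed

lemma ex1_permutes_eq_on:
  assumes "bij_betw f S S"
  shows "\<exists>!p. p permutes S \<and> (\<forall>x\<in>S. f x = p x)"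
proof (rule ex1I)
  let ?p = "\<lambda>x. if x \<in> S then f x else x"
  have "bij_betw ?p S S" using assms by (simp cong: bij_betw_cong)
  then show "?p permutes S \<and> (\<forall>x\<in>S. f x = ?p x)"
    by (auto intro: bij_imp_permutes)
  show "q = ?p" if "q permutes S \<and> (\<forall>x\<in>S. f x = q x)" for q
    using that by (auto simp: fun_eq_iff permutes_def)
qed

text \<open>Composition with \<open>p\<close> on the left carries the permutations that fix
  \<open>i\<close> to those that agree with \<open>p\<close> at \<open>i\<close>.\<close>

lemma card_permutes_fixed_value:
  assumes "finite S" "i \<in> S" and p: "p permutes S"
  shows "card {q. q permutes S \<and> q i = p i} = fact (card S - 1)"
proof -
  have "bij_betw ((\<circ>) p) {q. q permutes S - {i}} {q. q permutes S \<and> q i = p i}"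
  proof (rule bij_betwI[where g = "(\<circ>) (inv p)"])
    show "(\<circ>) p \<in> {q. q permutes S - {i}} \<rightarrow> {q. q permutes S \<and> q i = p i}"
      using p by (auto intro: permutes_compose permutes_subset simp: permutes_not_in)
    show "(\<circ>) (inv p) \<in> {q. q permutes S \<and> q i = p i} \<rightarrow> {q. q permutes S - {i}}"
    proof
      fix q assume "q \<in> {q. q permutes S \<and> q i = p i}"
      then have "inv p \<circ> q permutes S" "(inv p \<circ> q) i = i"
        using p by (auto intro: permutes_compose permutes_inv simp: permutes_inverses)
      then have "inv p \<circ> q permutes S - {i}"
        by - (rule permutes_superset, auto)
      then show "inv p \<circ> q \<in> {q. q permutes S - {i}}" by simp
    qed
  qed (use p in \<open>auto simp: fun_eq_iff permutes_inverses\<close>)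
  from bij_betw_same_card[OF this] show ?thesis
    using assms by (simp add: card_permutations[OF refl])
qed

section \<open>Latin squares through bijective rows and columns\<close>

lemma bij_betw_self_iff_ex1:
  "bij_betw f S S \<longleftrightarrow> f ` S \<subseteq> S \<and> (\<forall>s\<in>S. \<exists>!j. j \<in> S \<and> f j = s)"
proof
  assume f: "bij_betw f S S"
  then have "\<exists>!j. j \<in> S \<and> f j = s" if "s \<in> S" for s
    using that unfolding bij_betw_def inj_on_def by (metis image_iff)
  with f show "f ` S \<subseteq> S \<and> (\<forall>s\<in>S. \<exists>!j. j \<in> S \<and> f j = s)"
    by (simp add: bij_betw_def)
next
  assume f: "f ` S \<subseteq> S \<and> (\<forall>s\<in>S. \<exists>!j. j \<in> S \<and> f j = s)"
  then have "inj_on f S" by (intro inj_onI) blast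
  moreover from f have "S \<subseteq> f ` S" by (metis imageI subsetI)
  ultimately show "bij_betw f S S" using f by (simp add: bij_betw_def subset_antisym)
qed

lemma latin_squares_iff:
  "L \<in> latin_squares n \<longleftrightarrow> L \<in> {1..n} \<rightarrow>\<^sub>E ({1..n} \<rightarrow>\<^sub>E {1..n}) \<and>
     (\<forall>i\<in>{1..n}. bij_betw (L i) {1..n} {1..n}) \<and>
     (\<forall>j\<in>{1..n}. bij_betw (\<lambda>i. L i j) {1..n} {1..n})"
proof -
  have "L i ` {1..n} \<subseteq> {1..n} \<and> (\<lambda>j. L j i) ` {1..n} \<subseteq> {1..n}"
    if L: "L \<in> {1..n} \<rightarrow>\<^sub>E ({1..n} \<rightarrow>\<^sub>E {1..n})" and i: "i \<in> {1..n}" for i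
    using PiE_mem[OF PiE_mem[OF L]] i by blast
  then show ?thesis
    unfolding latin_squares_def bij_betw_self_iff_ex1 mem_Collect_eq
    by (intro conj_cong refl ball_cong) simp_all
qed

lemma latin_squares_bij_row:
  "L \<in> latin_squares n \<Longrightarrow> i \<in> {1..n} \<Longrightarrow> bij_betw (L i) {1..n} {1..n}"
  by (simp add: latin_squares_iff)

lemma latin_squares_bij_col:
  "L \<in> latin_squares n \<Longrightarrow> j \<in> {1..n} \<Longrightarrow> bij_betw (\<lambda>i. L i j) {1..n} {1..n}"
  by (simp add: latin_squares_iff)

lemma latin_squares_eqI:
  assumes "L \<in> latin_squares n" "M \<in> latin_squares n"
    and "\<And>i j. i \<in> {1..n} \<Longrightarrow> j \<in> {1..n} \<Longrightarrow> L i j = M i j"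
  shows "L = M"
proof (rule PiE_ext)
  show LM: "L \<in> {1..n} \<rightarrow>\<^sub>E ({1..n} \<rightarrow>\<^sub>E {1..n})" "M \<in> {1..n} \<rightarrow>\<^sub>E ({1..n} \<rightarrow>\<^sub>E {1..n})"
    using assms(1,2) by (simp_all add: latin_squares_def)
  fix i assume i: "i \<in> {1..n}"
  show "L i = M i"
    by (rule PiE_ext[OF PiE_mem[OF LM(1) i] PiE_mem[OF LM(2) i] assms(3)[OF i]])
qed

section \<open>Symmetries of the set of Latin squares\<close>

definition permute_grid ::
  "nat \<Rightarrow> (nat \<Rightarrow> nat) \<Rightarrow> (nat \<Rightarrow> nat) \<Rightarrow> (nat \<Rightarrow> nat \<Rightarrow> nat) \<Rightarrow> nat \<Rightarrow> nat \<Rightarrow> nat" where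
  "permute_grid n p q L = (\<lambda>i\<in>{1..n}. \<lambda>j\<in>{1..n}. L (p i) (q j))"

definition transpose_grid :: "nat \<Rightarrow> (nat \<Rightarrow> nat \<Rightarrow> nat) \<Rightarrow> nat \<Rightarrow> nat \<Rightarrow> nat" where
  "transpose_grid n L = (\<lambda>i\<in>{1..n}. \<lambda>j\<in>{1..n}. L j i)"

text \<open>\<open>M\<close> may be arbitrary outside the index range; the restrictions produce the
  canonical representative. This covers permuted and transposed grids at once.\<close>

lemma restrict_grid_in_latin_squares:
  assumes "\<And>i. i \<in> {1..n} \<Longrightarrow> bij_betw (M i) {1..n} {1..n}"
    and "\<And>j. j \<in> {1..n} \<Longrightarrow> bij_betw (\<lambda>i. M i j) {1..n} {1..n}"
  shows "(\<lambda>i\<in>{1..n}. \<lambda>j\<in>{1..n}. M i j) \<in> latin_squares n"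
proof -
  have "(\<lambda>i\<in>{1..n}. \<lambda>j\<in>{1..n}. M i j) \<in> {1..n} \<rightarrow>\<^sub>E ({1..n} \<rightarrow>\<^sub>E {1..n})"
    using bij_betw_apply[OF assms(1)] by (intro restrict_PiE_iff[THEN iffD2] ballI)
  moreover have "bij_betw ((\<lambda>i\<in>{1..n}. \<lambda>j\<in>{1..n}. M i j) i) {1..n} {1..n}"
    if "i \<in> {1..n}" for i
    by (rule bij_betw_cong[THEN iffD2, OF _ assms(1)[OF that]]) (use that in simp)
  moreover have "bij_betw (\<lambda>i. (\<lambda>i\<in>{1..n}. \<lambda>j\<in>{1..n}. M i j) i j) {1..n} {1..n}"
    if "j \<in> {1..n}" for j
    by (rule bij_betw_cong[THEN iffD2, OF _ assms(2)[OF that]]) (use that in simp)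
  ultimately show ?thesis unfolding latin_squares_iff by blast
qed

lemma permute_grid_in_latin_squares:
  assumes L: "L \<in> latin_squares n" and p: "p permutes {1..n}" and q: "q permutes {1..n}"
  shows "permute_grid n p q L \<in> latin_squares n"
  unfolding permute_grid_def
proof (rule restrict_grid_in_latin_squares)
  fix i assume i: "i \<in> {1..n}"
  then have "p i \<in> {1..n}" "q i \<in> {1..n}"
    using permutes_in_image[OF p] permutes_in_image[OF q] by blast+
  then show "bij_betw (\<lambda>j. L (p i) (q j)) {1..n} {1..n}"
    "bij_betw (\<lambda>j. L (p j) (q i)) {1..n} {1..n}"
    using bij_betw_trans[OF permutes_imp_bij[OF q] latin_squares_bij_row[OF L]]
      bij_betw_trans[OF permutes_imp_bij[OF p] latin_squares_bij_col[OF L]]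
    by (simp_all add: comp_def)
qed

lemma transpose_grid_in_latin_squares:
  "L \<in> latin_squares n \<Longrightarrow> transpose_grid n L \<in> latin_squares n"
  unfolding transpose_grid_def
  by (intro restrict_grid_in_latin_squares latin_squares_bij_row latin_squares_bij_col)

lemma transpose_grid_transpose_grid:
  "L \<in> latin_squares n \<Longrightarrow> transpose_grid n (transpose_grid n L) = L"
  by (rule latin_squares_eqI)
    (auto simp: transpose_grid_in_latin_squares, auto simp: transpose_grid_def)

lemma inj_on_permute_grid:
  assumes p: "p permutes {1..n}" and q: "q permutes {1..n}"
  shows "inj_on (permute_grid n p q) (latin_squares n)"
proof (rule inj_onI)
  fix L M assume LM: "L \<in> latin_squares n" "M \<in> latin_squares n"
    and eq: "permute_grid n p q L = permute_grid n p q M"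
  show "L = M"
  proof (rule latin_squares_eqI[OF LM])
    fix i j assume "i \<in> {1..n}" "j \<in> {1..n}"
    then have "inv p i \<in> {1..n}" "inv q j \<in> {1..n}"
      using permutes_in_image[OF permutes_inv[OF p]] permutes_in_image[OF permutes_inv[OF q]]
      by blast+
    \<comment> \<open>The entry at \<open>(i, j)\<close> has moved to this position.\<close>
    with fun_cong[OF fun_cong[OF eq], of "inv p i" "inv q j"]
    show "L i j = M i j"
      by (simp add: permute_grid_def permutes_inverses[OF p] permutes_inverses[OF q])
  qed
qed

section \<open>Equidistribution of a row, and of a column given a row\<close>

text \<open>Permuting columns by \<open>inv \<sigma> \<circ> \<pi>\<close> injectively turns row
  \<open>\<sigma>\<close> into row \<open>\<pi>\<close>. Exchanging the two permutations gives the
  reverse inequality.\<close>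

lemma card_row_le:
  assumes "\<sigma> permutes {1..n}" "\<pi> permutes {1..n}" "i \<in> {1..n}"
  shows "card {L \<in> latin_squares n. \<forall>j\<in>{1..n}. L i j = \<sigma> j}
    \<le> card {L \<in> latin_squares n. \<forall>j\<in>{1..n}. L i j = \<pi> j}"
proof (rule card_inj_on_le)
  let ?\<beta> = "inv \<sigma> \<circ> \<pi>"
  have \<beta>: "?\<beta> permutes {1..n}" using assms by (intro permutes_compose permutes_inv)
  show "inj_on (permute_grid n id ?\<beta>) {L \<in> latin_squares n. \<forall>j\<in>{1..n}. L i j = \<sigma> j}"
    using inj_on_permute_grid[OF permutes_id \<beta>] by (rule inj_on_subset) auto
  have "permute_grid n id ?\<beta> L i j = \<pi> j"
    if "\<forall>j\<in>{1..n}. L i j = \<sigma> j" "j \<in> {1..n}" for L j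
  proof -
    have "?\<beta> j \<in> {1..n}" using that(2) permutes_in_image[OF \<beta>] by blast
    then show ?thesis
      using that assms by (simp add: permute_grid_def permutes_inverses[OF assms(1)])
  qed
  then show "permute_grid n id ?\<beta> ` {L \<in> latin_squares n. \<forall>j\<in>{1..n}. L i j = \<sigma> j}
      \<subseteq> {L \<in> latin_squares n. \<forall>j\<in>{1..n}. L i j = \<pi> j}"
    using permute_grid_in_latin_squares[OF _ permutes_id \<beta>] by blast
qed (simp add: finite_latin_squares)

text \<open>Permuting rows by \<open>inv \<sigma> \<circ> \<tau>\<close> turns column
  \<open>\<sigma>\<close> into column \<open>\<tau>\<close>. By \<open>eq\<close> this permutation
  fixes \<open>i\<close>, so row \<open>i\<close> stays in place.\<close>

lemma card_row_col_le:
  assumes \<sigma>: "\<sigma> permutes {1..n}" and \<tau>: "\<tau> permutes {1..n}" and i: "i \<in> {1..n}"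
    and eq: "\<sigma> i = \<tau> i"
  shows "card {L \<in> latin_squares n. (\<forall>j\<in>{1..n}. L i j = \<pi> j) \<and> (\<forall>a\<in>{1..n}. L a i = \<sigma> a)}
    \<le> card {L \<in> latin_squares n. (\<forall>j\<in>{1..n}. L i j = \<pi> j) \<and> (\<forall>a\<in>{1..n}. L a i = \<tau> a)}"
    (is "card {L \<in> _. ?P L \<and> ?Q L} \<le> card ?B")
proof (rule card_inj_on_le)
  let ?\<alpha> = "inv \<sigma> \<circ> \<tau>"
  have \<alpha>: "?\<alpha> permutes {1..n}" using \<sigma> \<tau> by (intro permutes_compose permutes_inv)
  have \<alpha>i: "?\<alpha> i = i" using eq \<sigma> by (simp add: permutes_inverses flip: eq)
  show "inj_on (permute_grid n ?\<alpha> id) {L \<in> latin_squares n. ?P L \<and> ?Q L}"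
    using inj_on_permute_grid[OF \<alpha> permutes_id] by (rule inj_on_subset) auto
  have "permute_grid n ?\<alpha> id L i j = \<pi> j" if "?P L" "j \<in> {1..n}" for L j
    using that i \<alpha>i by (simp add: permute_grid_def)
  moreover have "permute_grid n ?\<alpha> id L a i = \<tau> a" if "?Q L" "a \<in> {1..n}" for L a
  proof -
    have "?\<alpha> a \<in> {1..n}" using that(2) permutes_in_image[OF \<alpha>] by blast
    then show ?thesis
      using that i by (simp add: permute_grid_def permutes_inverses[OF \<sigma>])
  qed
  ultimately show "permute_grid n ?\<alpha> id ` {L \<in> latin_squares n. ?P L \<and> ?Q L} \<subseteq> ?B"
    using permute_grid_in_latin_squares[OF _ \<alpha> permutes_id] by blast
qed (simp add: finite_latin_squares)

text \<open>The squares are sorted by the permutation in row \<open>i\<close>; all \<open>n!\<close>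
  classes have the same size. The product form avoids division of naturals.\<close>

lemma card_latin_squares_row:
  assumes \<pi>: "\<pi> permutes {1..n}" and i: "i \<in> {1..n}"
  shows "card (latin_squares n) =
    card {L \<in> latin_squares n. \<forall>j\<in>{1..n}. L i j = \<pi> j} * fact n"
proof -
  have "card (latin_squares n) =
      card {L \<in> latin_squares n. \<forall>j\<in>{1..n}. L i j = \<pi> j} * card {\<sigma>. \<sigma> permutes {1..n}}"
  proof (rule card_eq_mult_fibres)
    show "\<exists>!\<sigma>. \<sigma> \<in> {\<sigma>. \<sigma> permutes {1..n}} \<and> (\<forall>j\<in>{1..n}. L i j = \<sigma> j)"
      if "L \<in> latin_squares n" for L
      using ex1_permutes_eq_on[OF latin_squares_bij_row[OF that i]] by simp
    show "card {L \<in> latin_squares n. \<forall>j\<in>{1..n}. L i j = \<sigma> j} =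
        card {L \<in> latin_squares n. \<forall>j\<in>{1..n}. L i j = \<pi> j}" if "\<sigma> \<in> {\<sigma>. \<sigma> permutes {1..n}}" for \<sigma>
      using that \<pi> i by (intro antisym card_row_le) auto
  qed (auto simp: finite_latin_squares finite_permutations)
  then show ?thesis by (simp add: card_permutations[OF refl])
qed

text \<open>Row \<open>i\<close> prescribes the entry at \<open>(i, i)\<close>, which leaves
  \<open>(n-1)!\<close> equally frequent permutations for column \<open>i\<close>.\<close>

lemma card_latin_squares_row_col:
  assumes \<pi>: "\<pi> permutes {1..n}" and i: "i \<in> {1..n}"
  shows "card {L \<in> latin_squares n. \<forall>j\<in>{1..n}. L i j = \<pi> j} =
    card {L \<in> latin_squares n. (\<forall>j\<in>{1..n}. L i j = \<pi> j) \<and> (\<forall>a\<in>{1..n}. L a i = \<pi> a)} * fact (n - 1)"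
proof -
  let ?A = "{L \<in> latin_squares n. \<forall>j\<in>{1..n}. L i j = \<pi> j}"
  let ?F = "{\<tau>. \<tau> permutes {1..n} \<and> \<tau> i = \<pi> i}"
  have "card ?A =
      card {L \<in> latin_squares n. (\<forall>j\<in>{1..n}. L i j = \<pi> j) \<and> (\<forall>a\<in>{1..n}. L a i = \<pi> a)} * card ?F"
  proof (rule card_eq_mult_fibres)
    show "finite ?A" by (simp add: finite_latin_squares)
    show "finite ?F"
      by (rule finite_subset[OF _ finite_permutations[of "{1..n}"]]) auto
    show "\<exists>!\<tau>. \<tau> \<in> ?F \<and> (\<forall>a\<in>{1..n}. L a i = \<tau> a)" if L: "L \<in> ?A" for L
    proof -
      have "L i i = \<pi> i" using L i by blast
      moreover have "\<exists>!\<tau>. \<tau> permutes {1..n} \<and> (\<forall>a\<in>{1..n}. L a i = \<tau> a)"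
        using ex1_permutes_eq_on[OF latin_squares_bij_col[OF _ i]] L by simp
      ultimately have "\<exists>!\<tau>. (\<tau> permutes {1..n} \<and> \<tau> i = \<pi> i) \<and> (\<forall>a\<in>{1..n}. L a i = \<tau> a)"
        using i by metis
      then show ?thesis by simp
    qed
    show "card {L \<in> ?A. \<forall>a\<in>{1..n}. L a i = \<tau> a} =
        card {L \<in> latin_squares n. (\<forall>j\<in>{1..n}. L i j = \<pi> j) \<and> (\<forall>a\<in>{1..n}. L a i = \<pi> a)}"
      if "\<tau> \<in> ?F" for \<tau>
      using that \<pi> i card_row_col_le[of \<tau> n \<pi> i \<pi>] card_row_col_le[of \<pi> n \<tau> i \<pi>]
      by (simp add: conj_assoc)
  qed
  then show ?thesis
    using card_permutes_fixed_value[OF _ i \<pi>] by simp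
qed

section \<open>Inclusion-exclusion\<close>

theorem theorem8:
  fixes n :: nat and \<pi> :: "nat \<Rightarrow> nat"
  assumes "n \<ge> 1" and "\<pi> permutes {1..n}"
  shows "real (num_latin_squares_avoiding n n \<pi>) =
           ((fact n - real n) / fact n)\<^sup>2 * real (num_latin_squares n)"
proof -
  let ?X = "latin_squares n"
  let ?row = "\<lambda>L i. \<forall>j\<in>{1..n}. L i j = \<pi> j"
  let ?col = "\<lambda>L j. \<forall>i\<in>{1..n}. L i j = \<pi> i"
  let ?R = "{L \<in> ?X. \<exists>i\<in>{1..n}. ?row L i}"
  let ?C = "{L \<in> ?X. \<exists>j\<in>{1..n}. ?col L j}"
  note \<pi> = assms(2)
  have one: "1 \<in> {1..n}" using assms(1) by simp
  define N where "N = card ?X"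
  \<comment> \<open>Index 1 exists since \<open>n \<ge> 1\<close>. Cancelling the factorials shows
    below that every other index gives the same counts \<open>a\<close> and
    \<open>b\<close>.\<close>
  define a where "a = card {L \<in> ?X. ?row L 1}"
  define b where "b = card {L \<in> ?X. ?row L 1 \<and> ?col L 1}"
  have N: "N = a * fact n"
    unfolding N_def a_def by (rule card_latin_squares_row[OF \<pi> one])
  have a: "a = b * fact (n - 1)"
    unfolding a_def b_def by (rule card_latin_squares_row_col[OF \<pi> one])
  have row_card: "card {L \<in> ?X. ?row L i} = a" if "i \<in> {1..n}" for i
    using card_latin_squares_row[OF \<pi> that] N unfolding N_def by simp
  have row_col_card: "card {L \<in> ?X. ?row L i \<and> ?col L i} = b" if "i \<in> {1..n}" for i
    using card_latin_squares_row_col[OF \<pi> that] row_card[OF that] a by simp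
  have inj: "i = j" if "\<pi> i = \<pi> j" for i j
    using that permutes_inj[OF \<pi>] by (simp add: inj_eq)
  have row_unique: "i = k" if L: "L \<in> ?X" and "i \<in> {1..n}" "k \<in> {1..n}" "?row L i" "?row L k" for L i k
    \<comment> \<open>Two equal rows would repeat a symbol in column 1.\<close>
    using latin_squares_bij_col[OF L one] that one unfolding bij_betw_def inj_on_def by metis
  have R: "card ?R = a * n"
  proof -
    have "card ?R = a * card {1..n}"
    proof (rule card_eq_mult_fibres[where R = ?row])
      show "\<exists>!i. i \<in> {1..n} \<and> ?row L i" if "L \<in> ?R" for L
        using that row_unique by blast
      show "card {L \<in> ?R. ?row L i} = a" if "i \<in> {1..n}" for i
      proof -
        have "{L \<in> ?R. ?row L i} = {L \<in> ?X. ?row L i}" using that by blast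
        then show ?thesis using row_card[OF that] by simp
      qed
    qed (simp_all add: finite_latin_squares)
    then show ?thesis by simp
  qed
  have "bij_betw (transpose_grid n) ?R ?C"
  proof (rule bij_betwI[where g = "transpose_grid n"])
    have "?col (transpose_grid n L) i" if "?row L i" "i \<in> {1..n}" for L i
      using that by (simp add: transpose_grid_def)
    then show "transpose_grid n \<in> ?R \<rightarrow> ?C"
      using transpose_grid_in_latin_squares by blast
    have "?row (transpose_grid n L) i" if "?col L i" "i \<in> {1..n}" for L i
      using that by (simp add: transpose_grid_def)
    then show "transpose_grid n \<in> ?C \<rightarrow> ?R"
      using transpose_grid_in_latin_squares by blast
  qed (simp_all add: transpose_grid_transpose_grid)
  from bij_betw_same_card[OF this] have C: "card ?C = a * n"
    using R by (rule trans[OF sym])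
  \<comment> \<open>The entry at \<open>(i, j)\<close> is \<open>\<pi> j\<close> by its row and
    \<open>\<pi> i\<close> by its column.\<close>
  have diag: "i = j" if "?row L i" "?col L j" "i \<in> {1..n}" "j \<in> {1..n}" for L i j
    using that inj by metis
  have RC: "card (?R \<inter> ?C) = b * n"
  proof -
    have "card (?R \<inter> ?C) = b * card {1..n}"
    proof (rule card_eq_mult_fibres[where R = "\<lambda>L i. ?row L i \<and> ?col L i"])
      show "\<exists>!i. i \<in> {1..n} \<and> ?row L i \<and> ?col L i" if L: "L \<in> ?R \<inter> ?C" for L
      proof -
        obtain i j where ij: "i \<in> {1..n}" "?row L i" "j \<in> {1..n}" "?col L j"
          using L by blast
        with diag have "i = j" by blast
        show ?thesis
        proof (rule ex1I[of _ i])
          show "i \<in> {1..n} \<and> ?row L i \<and> ?col L i" using ij \<open>i = j\<close> by blast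
          \<comment> \<open>Uniqueness comes from \<open>diag\<close> as well, applied to row
            \<open>i\<close> and column \<open>k\<close>.\<close>
          show "k = i" if "k \<in> {1..n} \<and> ?row L k \<and> ?col L k" for k
            using diag[of L i k] ij that by blast
        qed
      qed
      show "card {L \<in> ?R \<inter> ?C. ?row L i \<and> ?col L i} = b" if "i \<in> {1..n}" for i
      proof -
        have "{L \<in> ?R \<inter> ?C. ?row L i \<and> ?col L i} = {L \<in> ?X. ?row L i \<and> ?col L i}"
          using that by blast
        then show ?thesis using row_col_card[OF that] by simp
      qed
    qed (simp_all add: finite_latin_squares)
    then show ?thesis by simp
  qed
  have "{L \<in> ?X. latin_square_avoids n L n \<pi>} = ?X - (?R \<union> ?C)"
    unfolding latin_square_avoids_def
    using contains_pattern_full_iff[OF latin_squares_bij_row \<pi>]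
      contains_pattern_full_iff[OF latin_squares_bij_col \<pi>] by blast
  then have "num_latin_squares_avoiding n n \<pi> = card (?X - (?R \<union> ?C))"
    by (simp add: num_latin_squares_avoiding_def)
  \<comment> \<open>Counts are kept as sums, free of truncated subtraction, until the passage to
    reals.\<close>
  moreover have "card (?X - (?R \<union> ?C)) + card (?R \<union> ?C) = N"
  proof -
    have "card (?R \<union> ?C) \<le> card ?X"
      by (intro card_mono finite_latin_squares) auto
    moreover have "card (?X - (?R \<union> ?C)) = card ?X - card (?R \<union> ?C)"
      by (intro card_Diff_subset) (auto simp: finite_latin_squares)
    ultimately show ?thesis by (simp add: N_def)
  qed
  moreover have "card (?R \<union> ?C) + b * n = a * n + a * n"
    using card_Un_Int[of ?R ?C] R C RC by (simp add: finite_latin_squares)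
  ultimately have "num_latin_squares_avoiding n n \<pi> + 2 * a * n = N + b * n"
    by simp
  from arg_cong[OF this, of real] have avoiding:
    "real (num_latin_squares_avoiding n n \<pi>) = real N + real b * n - 2 * real a * n"
    by (simp add: algebra_simps)
  \<comment> \<open>In terms of \<open>b\<close>, \<open>n\<close> and \<open>g\<close> one has
    \<open>n! = n * g\<close>, \<open>a = b * g\<close> and \<open>N = b * g * (n * g)\<close>; both
    sides of the claim then equal \<open>b * n * (g - 1)\<close> times \<open>g - 1\<close>.\<close>
  define g :: real where "g = fact (n - 1)"
  have fact_n: "fact n = real n * g" and "g \<noteq> 0" "real n \<noteq> 0"
    using assms(1) by (simp_all add: fact_reduce g_def)
  have real_a: "real a = b * g" and real_N: "real N = b * g * (n * g)"
    using N a fact_n by (simp_all add: g_def)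
  have "((n * g - real n) / (n * g))\<^sup>2 * (b * g * (n * g)) =
      b * g * (n * g) + real b * n - 2 * (b * g) * n"
    using \<open>g \<noteq> 0\<close> \<open>real n \<noteq> 0\<close> by (simp add: field_simps power2_eq_square)
  moreover have "num_latin_squares n = N" by (simp add: num_latin_squares_def N_def)
  ultimately show ?thesis
    by (simp add: avoiding fact_n real_a real_N)
qed

end
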